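(* For every integer $n\ge 0$, $$\sum_{k=0}^{n} 2^{\,n-k}\,s(n,k)\,B_k \;=\; \sum_{k=0}^{n} b(n,k)\,\frac{(-1)^k\,k!}{k+1},$$ where $s(n,k)$ are the (signed) Stirling numbers of the first kind, $B_k$ are the Bernoulli numbers, and $b(n,k)$ are the (signed) Bessel numbers of the first kind.
   Context: Bernoulli numbers $B_n$ are defined by $\frac{t}{e^t-1}=\sum_{n=0}^{\infty}B_n\frac{t^n}{n!}$ for $|t|<2\pi$ (so $B_1=-\tfrac12$). The (signed) Stirling numbers of the first kind $s(n,k)$ are defined by $(x)_n := x(x-1)\cdots(x-n+1)=\sum_{k=0}^{n}s(n,k)\,x^k$, with $(x)_0=1$. The Bessel numbers of the first kind $b(n,k)$ (signed) are given for $1\le k\le n$ by $$b(n,k)=(-1)^{n-k}\,\frac{(2n-k-1)!}{2^{\,n-k}\,(k-1)!\,(n-k)!},$$ with $b(n,k)=0$ for $0\le n<k$, and for $k=0$ by $b(0,0)=1$ and $b(n,0)=0$ for $n\ge1$. Equivalently, they are the coefficients in the operator identity $(x^{-1}D)^n=\sum_{k=0}^{n}b(n,k)\,x^{k-2n}D^k$, where $D=\frac{d}{dx}$. *)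

theory Defs
  imports
    "HOL-Complex_Analysis.Complex_Analysis"
    "HOL-Combinatorics.Stirling"
begin

definition bernoulli :: "nat \<Rightarrow> real" where
  "bernoulli n = fact n * fps_nth (fps_X / (fps_exp 1 - 1)) n"

text \<open>
  The formal definition of \<open>bernoulli\<close> agrees with the analytic one: the series converges to
  \<open>t / (exp t - 1)\<close> on the whole disc of radius \<open>2 * pi\<close>, where the removable singularity
  at \<open>0\<close> is filled in by its limit \<open>1\<close>.
\<close>

lemma bernoulli_sums:
  fixes t :: complex
  assumes "norm t < 2 * pi"
  shows "(\<lambda>n. of_real (bernoulli n) * t ^ n / fact n) sums
           (if t = 0 then 1 else t / (exp t - 1))"
proof -
  define f :: "complex \<Rightarrow> complex" where "f = (\<lambda>t. if t = 0 then 1 else t / (exp t - 1))"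
  have nz: "exp z \<noteq> 1" if "norm z < 2 * pi" "z \<noteq> 0" for z :: complex
  proof
    assume "exp z = 1"
    then obtain n :: int where n: "Re z = 0" "Im z = real_of_int (2 * n) * pi"
      by (auto simp: exp_eq_1)
    with that have "n \<noteq> 0" by (auto simp: complex_eq_iff)
    then have "1 \<le> \<bar>real_of_int n\<bar>" by linarith
    then have "2 * pi \<le> \<bar>Im z\<bar>" using n by (simp add: abs_mult)
    also have "\<dots> \<le> norm z" by (rule abs_Im_le_cmod)
    finally show False using that by simp
  qed
  have sd: "subdegree (fps_exp 1 - 1 :: 'a :: field_char_0 fps) = 1"
    by (rule subdegreeI) auto
  have sd': "subdegree (1 - fps_exp 1 :: 'a :: field_char_0 fps) = 1"
    by (rule subdegreeI) auto
  from sd have ne: "fps_exp 1 - 1 \<noteq> (0 :: 'a :: field_char_0 fps)"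
    by (metis subdegree_0 zero_neq_one)
  have exp: "f has_fps_expansion fps_X / (fps_exp 1 - 1)"
    unfolding f_def
    by (intro has_fps_expansion_divide fps_expansion_intros) (auto simp: sd sd' ne)
  have "continuous (at 0) f"
    using has_fps_expansion_imp_continuous[OF exp] .
  then have cont: "(f \<longlongrightarrow> f 0) (at 0)"
    by (simp add: continuous_within)
  have "(\<lambda>t. t / (exp t - 1)) holomorphic_on (ball 0 (2 * pi) - {0})"
    using nz by (intro holomorphic_intros) auto
  then have "f holomorphic_on (ball 0 (2 * pi) - {0})"
    by (rule holomorphic_transform) (auto simp: f_def)
  then have "f holomorphic_on ball 0 (2 * pi)"
    by (rule no_isolated_singularity'[rotated]) (auto intro: tendsto_within_subset[OF cont])
  then have "f holomorphic_on eball 0 (ereal (2 * pi))"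
    by simp
  from has_fps_expansion_imp_sums_complex[OF exp this, of t] assms
  have sums: "(\<lambda>n. fps_nth (fps_X / (fps_exp 1 - 1)) n * t ^ n) sums f t"
    by simp
  define R :: "real fps" where "R = fps_X / (fps_exp 1 - 1)"
  define C :: "complex fps" where "C = Abs_fps (\<lambda>n. of_real (fps_nth R n))"
  have R: "R * (fps_exp 1 - 1) = fps_X"
    unfolding R_def by (intro dvd_div_mult_self) (simp add: fps_dvd_iff ne sd sd')
  have "C * (fps_exp 1 - 1) = fps_X"
  proof (rule fps_ext)
    fix n
    have "fps_nth (C * (fps_exp 1 - 1)) n = of_real (fps_nth (R * (fps_exp 1 - 1)) n)"
      by (simp add: fps_mult_nth C_def if_distrib cong: if_cong)
    also have "\<dots> = fps_nth fps_X n"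
      by (simp add: R)
    finally show "fps_nth (C * (fps_exp 1 - 1)) n = fps_nth fps_X n" .
  qed
  then have "fps_X / (fps_exp 1 - 1) = C"
    by (metis ne nonzero_mult_div_cancel_right)
  then have "fps_nth (fps_X / (fps_exp 1 - 1) :: complex fps) n = of_real (bernoulli n) / fact n" for n
    by (simp add: C_def bernoulli_def R_def)
  then show ?thesis using sums by (simp add: f_def)
qed

text \<open>Signed Stirling numbers of the first kind, the coefficients of the falling factorial.\<close>

definition stirling1 :: "nat \<Rightarrow> nat \<Rightarrow> int" where
  "stirling1 n k = poly.coeff (\<Prod>i<n. [:- int i, 1:]) k"

lemma stirling1_eq_stirling:
  assumes "k \<le> n"
  shows "stirling1 n k = (- 1) ^ (n - k) * int (stirling n k)"
proof -
  have "poly.coeff (\<Prod>i<n. [:- int i, 1:]) k = (- 1) ^ (n + k) * int (stirling n k)" for n k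
  proof (induction n arbitrary: k)
    case 0
    show ?case by (cases k) auto
  next
    case (Suc n)
    have "int n * int (stirling n 0) = 0" by (cases n) auto
    then show ?case by (cases k) (auto simp: Suc.IH algebra_simps)
  qed
  moreover have "(- 1) ^ (n + k) = ((- 1) ^ (n - k) :: int)"
    using assms by (simp add: minus_one_power_iff)
  ultimately show ?thesis by (simp add: stirling1_def)
qed

definition bessel1 :: "nat \<Rightarrow> nat \<Rightarrow> real" where
  "bessel1 n k =
     (if k = 0 then (if n = 0 then 1 else 0)
      else if n < k then 0
      else (- 1) ^ (n - k) * fact (2 * n - k - 1) / (2 ^ (n - k) * fact (k - 1) * fact (n - k)))"

end

theory Submission
  imports Defs
begin

text \<open>
  Let \<open>L\<close> be the Bernoulli functional, the linear functional on polynomials with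
  \<open>L (x ^ k) = B\<^sub>k\<close>. It satisfies \<open>L (p (x + 1)) - L (p x) = p' 0\<close>, and applying this to a falling
  factorial gives \<open>L ((x)\<^sub>k) = (-1) ^ k * k! / (k + 1)\<close>. Hence the theorem is the image under \<open>L\<close> of
  the polynomial identity \<open>x (x - 2) \<cdots> (x - 2 (n - 1)) = (\<Sum>k\<le>n. b(n,k) (x)\<^sub>k)\<close>, which is the
  operator identity for \<open>(x\<^sup>-\<^sup>1 D) ^ n\<close> applied to a power of \<open>x\<close>.
\<close>

text \<open>Compare coefficients of \<open>X^n\<close> in \<open>R * (e^X - 1) = X\<close>. The
  index \<open>j = n\<close> drops out because \<open>e^X - 1\<close> has constant coefficient
  0.\<close>

lemma sum_binomial_bernoulli:
  "(\<Sum>j<n. of_nat (n choose j) * bernoulli j) = (if n = 1 then 1 else 0)"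
proof -
  define R :: "real fps" where "R = fps_X / (fps_exp 1 - 1)"
  have sd: "subdegree (fps_exp 1 - 1 :: real fps) = 1"
    by (rule subdegreeI) auto
  have sd': "subdegree (1 - fps_exp 1 :: real fps) = 1"
    by (rule subdegreeI) auto
  from sd have "fps_exp 1 - 1 \<noteq> (0 :: real fps)"
    by (metis subdegree_0 zero_neq_one)
  then have R: "R * (fps_exp 1 - 1) = fps_X"
    unfolding R_def by (intro dvd_div_mult_self) (simp add: fps_dvd_iff sd sd')
  have "(\<Sum>j<n. of_nat (n choose j) * bernoulli j)
      = (\<Sum>j<n. fact n * (fps_nth R j * fps_nth (fps_exp 1 - 1) (n - j)))"
    by (intro sum.cong) (auto simp: bernoulli_def R_def binomial_fact)
  also have "\<dots> = fact n * (\<Sum>j=0..n. fps_nth R j * fps_nth (fps_exp 1 - 1) (n - j))"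
    by (simp add: sum_distrib_left atLeast0AtMost lessThan_Suc_atMost[symmetric])
  also have "\<dots> = fact n * fps_nth fps_X n"
    by (simp add: R[symmetric] fps_mult_nth)
  finally show ?thesis by simp
qed

definition bernoulli_functional :: "real poly \<Rightarrow> real" where
  "bernoulli_functional p = (\<Sum>k\<le>degree p. poly.coeff p k * bernoulli k)"

text \<open>Coefficients beyond the degree vanish, so polynomials of different degrees can be summed
  over one common range; linearity rests on this.\<close>

lemma bernoulli_functional_eq:
  assumes "degree p \<le> n"
  shows "bernoulli_functional p = (\<Sum>k\<le>n. poly.coeff p k * bernoulli k)"
  unfolding bernoulli_functional_def
  using assms by (intro sum.mono_neutral_left) (auto simp: coeff_eq_0)

lemma bernoulli_functional_add:
  "bernoulli_functional (p + q) = bernoulli_functional p + bernoulli_functional q"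
proof -
  define n where "n = max (degree p) (degree q)"
  have "degree (p + q) \<le> n" "degree p \<le> n" "degree q \<le> n"
    by (auto simp: n_def degree_add_le_max)
  then show ?thesis
    by (simp add: bernoulli_functional_eq[of _ n] sum.distrib algebra_simps)
qed

lemma bernoulli_functional_smult:
  "bernoulli_functional (smult c p) = c * bernoulli_functional p"
  by (simp add: bernoulli_functional_eq[of _ "degree p"] degree_smult_le sum_distrib_left
      mult.assoc)

lemma bernoulli_functional_sum:
  "bernoulli_functional (\<Sum>i\<in>A. f i) = (\<Sum>i\<in>A. bernoulli_functional (f i))"
proof -
  have "bernoulli_functional 0 = 0"
    using bernoulli_functional_smult[of 0 0] by simp
  then show ?thesis
    by (induction A rule: infinite_finite_induct) (simp_all add: bernoulli_functional_add)
qed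

lemma bernoulli_functional_shift_power:
  "bernoulli_functional ([:1, 1:] ^ n) = bernoulli n + (if n = 1 then 1 else 0)"
proof -
  have "degree ([:1, 1:] ^ n :: real poly) \<le> n"
    by (simp add: degree_power_eq)
  then have "bernoulli_functional ([:1, 1:] ^ n)
      = (\<Sum>k\<le>n. of_nat (n choose k) * bernoulli k)"
    by (simp add: bernoulli_functional_eq coeff_linear_poly_power)
  also have "\<dots> = (\<Sum>k<n. of_nat (n choose k) * bernoulli k) + bernoulli n"
    by (simp add: lessThan_Suc_atMost[symmetric])
  finally show ?thesis by (simp add: sum_binomial_bernoulli)
qed

text \<open>By linearity it suffices to treat powers of \<open>x\<close>, and among these only
  \<open>k = 1\<close> contributes a correction.\<close>

lemma bernoulli_functional_shift:
  "bernoulli_functional (pcompose p [:1, 1:]) = bernoulli_functional p + poly.coeff p 1"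
proof -
  have "bernoulli_functional (pcompose p [:1, 1:])
      = bernoulli_functional (\<Sum>k\<le>degree p. smult (poly.coeff p k) ([:1, 1:] ^ k))"
    by (simp add: pcompose_altdef poly_altdef degree_map_poly coeff_map_poly)
  also have "\<dots> = (\<Sum>k\<le>degree p. poly.coeff p k * bernoulli k
                     + (if k = 1 then poly.coeff p 1 else 0))"
    by (auto simp: bernoulli_functional_sum bernoulli_functional_smult
        bernoulli_functional_shift_power algebra_simps intro!: sum.cong)
  \<comment> \<open>If \<open>p\<close> is constant, the index 1 lies outside the sum, but then
    \<open>poly.coeff p 1\<close> is 0 as well.\<close>
  also have "\<dots> = bernoulli_functional p + poly.coeff p 1"
    by (auto simp: sum.distrib bernoulli_functional_def coeff_eq_0)
  finally show ?thesis .
qed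

definition ffact_poly :: "nat \<Rightarrow> real poly" where
  "ffact_poly n = (\<Prod>i<n. [:- real i, 1:])"

lemma ffact_poly_0 [simp]: "ffact_poly 0 = 1"
  by (simp add: ffact_poly_def)

lemma ffact_poly_Suc: "ffact_poly (Suc n) = [:- real n, 1:] * ffact_poly n"
  by (simp add: ffact_poly_def mult.commute)

text \<open>The shift turns each factor \<open>x - i\<close> into \<open>x - (i - 1)\<close>: the
  factor for \<open>i = 0\<close> becomes \<open>x + 1\<close>, the others run through those of
  \<open>ffact_poly n\<close>.\<close>

lemma pcompose_ffact_poly_Suc:
  "pcompose (ffact_poly (Suc n)) [:1, 1:] = [:1, 1:] * ffact_poly n"
proof (induction n)
  case 0
  show ?case by (simp add: ffact_poly_Suc pcompose_mult pcompose_pCons)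
next
  case (Suc n)
  have "pcompose (ffact_poly (Suc (Suc n))) [:1, 1:]
      = [:- real n, 1:] * pcompose (ffact_poly (Suc n)) [:1, 1:]"
    unfolding ffact_poly_Suc[of "Suc n"] pcompose_mult by (simp add: pcompose_pCons)
  also have "\<dots> = [:1, 1:] * ffact_poly (Suc n)"
    unfolding Suc by (simp only: ffact_poly_Suc[of n] mult.left_commute)
  finally show ?case .
qed

lemma coeff_0_ffact_poly_Suc: "poly.coeff (ffact_poly (Suc n)) 0 = 0"
  by (induction n) (simp_all add: ffact_poly_Suc)

lemma coeff_1_ffact_poly_Suc: "poly.coeff (ffact_poly (Suc n)) 1 = (-1) ^ n * fact n"
proof (induction n)
  case 0
  show ?case by (simp add: ffact_poly_Suc)
next
  case (Suc n)
  then show ?case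
    using coeff_0_ffact_poly_Suc[of n]
    by (subst ffact_poly_Suc) (simp add: algebra_simps)
qed

text \<open>The forward difference of \<open>ffact_poly (Suc n)\<close> is
  \<open>(n + 1) * ffact_poly n\<close>, and the functional sends a forward difference to the linear
  coefficient.\<close>

lemma bernoulli_functional_ffact_poly:
  "bernoulli_functional (ffact_poly n) = (-1) ^ n * fact n / (real n + 1)"
proof -
  have "pcompose (ffact_poly (Suc n)) [:1, 1:]
      = ffact_poly (Suc n) + smult (real n + 1) (ffact_poly n)"
    unfolding pcompose_ffact_poly_Suc by (simp add: ffact_poly_Suc smult_add_left)
  from arg_cong[OF this, of bernoulli_functional]
  have "(real n + 1) * bernoulli_functional (ffact_poly n) = (-1) ^ n * fact n"
    by (simp add: bernoulli_functional_shift bernoulli_functional_add bernoulli_functional_smult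
        coeff_1_ffact_poly_Suc[unfolded One_nat_def])
  then show ?thesis by (simp add: field_simps)
qed

definition double_ffact_poly :: "nat \<Rightarrow> real poly" where
  "double_ffact_poly n = (\<Prod>i<n. [:- 2 * real i, 1:])"

lemma double_ffact_poly_Suc:
  "double_ffact_poly (Suc n) = [:- 2 * real n, 1:] * double_ffact_poly n"
  by (simp add: double_ffact_poly_def mult.commute)

lemma degree_double_ffact_poly: "degree (double_ffact_poly n) = n"
  unfolding double_ffact_poly_def by (subst degree_prod_eq_sum_degree) auto

text \<open>This polynomial is \<open>2^n\<close> times the falling factorial at \<open>x/2\<close>.
  Keeping \<open>2^k\<close> on the left avoids truncated subtraction, so \<open>k\<close> can be
  arbitrary in the induction.\<close>

lemma coeff_double_ffact_poly:
  "2 ^ k * poly.coeff (double_ffact_poly n) k = 2 ^ n * of_int (stirling1 n k)"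
proof (induction n arbitrary: k)
  case 0
  show ?case by (cases k) (auto simp: double_ffact_poly_def stirling1_def)
next
  case (Suc n)
  have st: "stirling1 (Suc n) 0 = - int n * stirling1 n 0"
    "stirling1 (Suc n) (Suc k) = stirling1 n k - int n * stirling1 n (Suc k)" for k
    by (simp_all add: stirling1_def)
  show ?case
    using Suc.IH[of k] Suc.IH[of "k - 1"]
    by (cases k) (auto simp: double_ffact_poly_Suc st algebra_simps)
qed

text \<open>This recurrence reflects multiplication by \<open>x - 2n\<close> in the falling
  factorial basis: \<open>(x - 2n) (x)_k = (x)_{k+1} + (k - 2n) (x)_k\<close>.\<close>

lemma bessel1_Suc_Suc:
  "bessel1 (Suc n) (Suc k) = bessel1 n k + (real (Suc k) - 2 * real n) * bessel1 n (Suc k)"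
proof -
  \<comment> \<open>The last case is \<open>0 < k < n\<close>, where the factorial formula applies
    to all three Bessel numbers.\<close>
  consider "n < k" | "n = k" | "k = 0" "n > 0" | j d where "k = Suc j" "n = Suc (Suc (j + d))"
    by (metis less_imp_Suc_add linorder_neqE_nat not0_implies_Suc add_Suc neq0_conv)
  then show ?thesis
  proof cases
    case 3
    then obtain m where "n = Suc m" by (cases n) auto
    then have "2 * n - Suc k - 1 = 2 * m" "2 * Suc n - Suc k - 1 = Suc (Suc (2 * m))"
      "n - Suc k = m" "Suc n - Suc k = Suc m"
      using 3 by auto
    with 3 \<open>n = Suc m\<close> show ?thesis
      by (simp add: bessel1_def divide_simps) (simp add: algebra_simps)
  next
    case 4
    \<comment> \<open>The smallest of the three numerator factorials is \<open>m!\<close>; after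
      cancelling it, a polynomial identity in \<open>j\<close> and \<open>d\<close> remains.\<close>
    define m where "m = j + 2 * d + 1"
    have idx: "2 * n - k - 1 = Suc m" "2 * n - Suc k - 1 = m" "2 * Suc n - Suc k - 1 = Suc (Suc m)"
      "n - k = Suc d" "n - Suc k = d" "Suc n - Suc k = Suc d"
      using 4 by (auto simp: m_def)
    have vals: "bessel1 n k = (- 1) ^ Suc d * fact (Suc m) / (2 ^ Suc d * fact j * fact (Suc d))"
      "bessel1 n (Suc k) = (- 1) ^ d * fact m / (2 ^ d * fact (Suc j) * fact d)"
      "bessel1 (Suc n) (Suc k)
        = (- 1) ^ Suc d * fact (Suc (Suc m)) / (2 ^ Suc d * fact (Suc j) * fact (Suc d))"
      unfolding bessel1_def idx using 4 by simp_all
    have "real m = real j + 2 * real d + 1"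
      by (simp add: m_def)
    moreover have "real n = real j + real d + 2" "real (Suc k) = real j + 2"
      using 4 by simp_all
    ultimately show ?thesis
      unfolding vals by (simp add: divide_simps) (simp add: algebra_simps)
  qed (auto simp: bessel1_def)
qed

lemma double_ffact_poly_eq_sum:
  "double_ffact_poly n = (\<Sum>k\<le>n. smult (bessel1 n k) (ffact_poly k))"
proof (induction n)
  case 0
  show ?case by (simp add: double_ffact_poly_def bessel1_def)
next
  case (Suc n)
  have step: "[:- 2 * real n, 1:] * ffact_poly k
      = ffact_poly (Suc k) + smult (real k - 2 * real n) (ffact_poly k)" for k
    by (simp add: ffact_poly_Suc smult_diff_left)
  let ?f = "\<lambda>k. smult ((real k - 2 * real n) * bessel1 n k) (ffact_poly k)"
  have top: "bessel1 n (Suc n) = 0" and bot: "real n * bessel1 n 0 = 0"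
    "bessel1 (Suc n) 0 = 0"
    by (auto simp: bessel1_def)
  \<comment> \<open>Both ends vanish, at 0 by \<open>bot\<close> and at \<open>n + 1\<close> by
    \<open>top\<close>, so the index can be shifted by one to match
    \<open>ffact_poly (Suc k)\<close>.\<close>
  have "?f 0 = 0"
    using bot by simp
  then have "(\<Sum>k\<le>n. ?f k) = (\<Sum>k\<le>n. ?f (Suc k))"
    using sum.atMost_Suc[of ?f n] sum.atMost_Suc_shift[of ?f n] top by simp
  moreover have "double_ffact_poly (Suc n)
      = (\<Sum>k\<le>n. smult (bessel1 n k) (ffact_poly (Suc k))) + (\<Sum>k\<le>n. ?f k)"
    unfolding double_ffact_poly_Suc Suc sum_distrib_left mult_smult_right step
    by (simp add: smult_add_right sum.distrib mult.commute)
  ultimately have "double_ffact_poly (Suc n)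
      = (\<Sum>k\<le>n. smult (bessel1 (Suc n) (Suc k)) (ffact_poly (Suc k)))"
    by (simp add: bessel1_Suc_Suc smult_add_left sum.distrib)
  then show ?case
    by (simp add: sum.atMost_Suc_shift bot del: sum.atMost_Suc)
qed

theorem theorem2:
  fixes n :: nat
  shows "(\<Sum>k=0..n. 2 ^ (n - k) * of_int (stirling1 n k) * bernoulli k) =
         (\<Sum>k=0..n. bessel1 n k * ((- 1) ^ k * fact k / (real k + 1)))"
proof -
  have coeff: "2 ^ (n - k) * of_int (stirling1 n k) = poly.coeff (double_ffact_poly n) k"
    if "k \<le> n" for k
    using coeff_double_ffact_poly[of k n] that by (simp add: power_diff field_simps)
  have "(\<Sum>k=0..n. 2 ^ (n - k) * of_int (stirling1 n k) * bernoulli k)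
      = bernoulli_functional (double_ffact_poly n)"
    by (simp add: bernoulli_functional_def degree_double_ffact_poly atLeast0AtMost coeff)
  also have "\<dots> = (\<Sum>k=0..n. bessel1 n k * ((- 1) ^ k * fact k / (real k + 1)))"
    by (simp add: double_ffact_poly_eq_sum bernoulli_functional_sum bernoulli_functional_smult
        bernoulli_functional_ffact_poly atLeast0AtMost)
  finally show ?thesis .
qed

end
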